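(* Let $V=[n]$, $k\ge1$, $\varepsilon\in(0,1)$, $B$ a positive integer with $B\le n$, and let $F:(k+1)^V\to\mathbb{R}_{\ge0}$ be $\varepsilon$-approximately $k$-submodular. Let $\mathbf{x}$ be the output of the $k$-Greedy-TS algorithm applied to $F$ and $B$. Then $F(\mathbf{x})\ge\frac{(1-\varepsilon)^2}{2(1-\varepsilon+\varepsilon B)(1+\varepsilon)}\max_{\mathbf{y}\in(k+1)^V,\ |\mathrm{supp}(\mathbf{y})|\le B}F(\mathbf{y})$.
   Context: $(k+1)^V$ is the set of $k$-tuples $\mathbf{x}=(X_1,\dots,X_k)$ of pairwise disjoint subsets of $V$, identified with vectors $\mathbf{x}\in\{0,1,\dots,k\}^V$ via $\mathbf{x}(e)=i\iff e\in X_i$; $\mathbf{0}$ is the all-empty tuple; $\mathrm{supp}(\mathbf{x})=\{e:\mathbf{x}(e)\ne0\}$; $\mathbf{x}\preceq\mathbf{y}$ means $X_i\subseteq Y_i$ for all $i$. $\Delta_{u,i}g(\mathbf{x})=g(X_1,\dots,X_i\cup\{u\},\dots,X_k)-g(\mathbf{x})$ for $u\notin\mathrm{supp}(\mathbf{x})$. A function $f$ is $k$-submodular if $\Delta_{u,i}f(\mathbf{x})\ge\Delta_{u,i}f(\mathbf{y})$ whenever $\mathbf{x}\preceq\mathbf{y}$, $u\notin\mathrm{supp}(\mathbf{y})$, and $\Delta_{u,i}f(\mathbf{x})+\Delta_{u,j}f(\mathbf{x})\ge0$ for $i\ne j$; monotone if $\mathbf{x}\preceq\mathbf{y}\Rightarrow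 f(\mathbf{x})\le f(\mathbf{y})$. $F$ is $\varepsilon$-approximately $k$-submodular if there is a monotone $k$-submodular $f$ with $(1-\varepsilon)f(\mathbf{x})\le F(\mathbf{x})\le(1+\varepsilon)f(\mathbf{x})$ for all $\mathbf{x}$; normalization $F(\mathbf{0})=f(\mathbf{0})=0$. $k$-Greedy-TS: start with $\mathbf{x}^{(0)}=\mathbf{0}$; for $j=1,\dots,B$ pick $(e^{(j)},i^{(j)})\in\arg\max_{e\in V\setminus\mathrm{supp}(\mathbf{x}^{(j-1)}),\,i\in[k]}\Delta_{e,i}F(\mathbf{x}^{(j-1)})$ (ties arbitrary) and let $\mathbf{x}^{(j)}$ be $\mathbf{x}^{(j-1)}$ with $\mathbf{x}^{(j)}(e^{(j)})=i^{(j)}$; output $\mathbf{x}=\mathbf{x}^{(B)}$. *)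

theory Defs
  imports Complex_Main
begin

text \<open>
  A tuple of \<open>k\<close> pairwise disjoint subsets of \<open>V\<close> is encoded by the vector \<open>x\<close> with
  \<open>x e = i\<close> iff \<open>e\<close> lies in the \<open>i\<close>-th set, and \<open>x e = 0\<close> iff \<open>e\<close> lies in none of them.
  Vectors are fixed to be \<open>0\<close> outside \<open>V\<close>, so that each tuple has exactly one encoding.
\<close>

definition ktuples :: "'a set \<Rightarrow> nat \<Rightarrow> ('a \<Rightarrow> nat) set" where
  "ktuples V k = {x. (\<forall>e\<in>V. x e \<in> {0..k}) \<and> (\<forall>e. e \<notin> V \<longrightarrow> x e = 0)}"

definition zero_tuple :: "'a \<Rightarrow> nat" where
  "zero_tuple = (\<lambda>_. 0)"

definition part :: "'a set \<Rightarrow> ('a \<Rightarrow> nat) \<Rightarrow> nat \<Rightarrow> 'a set" where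
  "part V x i = {e\<in>V. x e = i}"

definition ksupp :: "'a set \<Rightarrow> ('a \<Rightarrow> nat) \<Rightarrow> 'a set" where
  "ksupp V x = {e\<in>V. x e \<noteq> 0}"

definition tuple_le :: "'a set \<Rightarrow> nat \<Rightarrow> ('a \<Rightarrow> nat) \<Rightarrow> ('a \<Rightarrow> nat) \<Rightarrow> bool" where
  "tuple_le V k x y \<longleftrightarrow> (\<forall>i\<in>{1..k}. part V x i \<subseteq> part V y i)"

text \<open>The marginal gain is only meaningful for \<open>u\<close> outside the support of \<open>x\<close>.\<close>

definition marginal :: "(('a \<Rightarrow> nat) \<Rightarrow> real) \<Rightarrow> 'a \<Rightarrow> nat \<Rightarrow> ('a \<Rightarrow> nat) \<Rightarrow> real" where
  "marginal g u i x = g (x(u := i)) - g x"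

definition k_submodular :: "'a set \<Rightarrow> nat \<Rightarrow> (('a \<Rightarrow> nat) \<Rightarrow> real) \<Rightarrow> bool" where
  "k_submodular V k f \<longleftrightarrow>
     (\<forall>x\<in>ktuples V k. \<forall>y\<in>ktuples V k. \<forall>u\<in>V - ksupp V y. \<forall>i\<in>{1..k}.
        tuple_le V k x y \<longrightarrow> marginal f u i x \<ge> marginal f u i y) \<and>
     (\<forall>x\<in>ktuples V k. \<forall>u\<in>V - ksupp V x. \<forall>i\<in>{1..k}. \<forall>j\<in>{1..k}.
        i \<noteq> j \<longrightarrow> marginal f u i x + marginal f u j x \<ge> 0)"

definition k_monotone :: "'a set \<Rightarrow> nat \<Rightarrow> (('a \<Rightarrow> nat) \<Rightarrow> real) \<Rightarrow> bool" where
  "k_monotone V k f \<longleftrightarrow>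
     (\<forall>x\<in>ktuples V k. \<forall>y\<in>ktuples V k. tuple_le V k x y \<longrightarrow> f x \<le> f y)"

text \<open>The standing normalization of \<open>F\<close> and of its witness \<open>f\<close> is part of the definition.\<close>

definition approx_k_submodular ::
  "'a set \<Rightarrow> nat \<Rightarrow> real \<Rightarrow> (('a \<Rightarrow> nat) \<Rightarrow> real) \<Rightarrow> bool" where
  "approx_k_submodular V k \<epsilon> F \<longleftrightarrow>
     F zero_tuple = 0 \<and>
     (\<exists>f. k_monotone V k f \<and> k_submodular V k f \<and> f zero_tuple = 0 \<and>
        (\<forall>x\<in>ktuples V k. (1 - \<epsilon>) * f x \<le> F x \<and> F x \<le> (1 + \<epsilon>) * f x))"

text \<open>
  \<open>k_greedy_TS V k F j x\<close>: after \<open>j\<close> iterations the algorithm can have reached \<open>x\<close>, for some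
  resolution of the ties.
\<close>

inductive k_greedy_TS ::
  "'a set \<Rightarrow> nat \<Rightarrow> (('a \<Rightarrow> nat) \<Rightarrow> real) \<Rightarrow> nat \<Rightarrow> ('a \<Rightarrow> nat) \<Rightarrow> bool"
  for V :: "'a set" and k :: nat and F :: "('a \<Rightarrow> nat) \<Rightarrow> real" where
  start: "k_greedy_TS V k F 0 zero_tuple"
| step: "k_greedy_TS V k F j x \<Longrightarrow>
    is_arg_max (\<lambda>(e, i). marginal F e i x)
      (\<lambda>(e, i). e \<in> V - ksupp V x \<and> i \<in> {1..k}) (e', i') \<Longrightarrow>
    k_greedy_TS V k F (Suc j) (x(e' := i'))"

lemma finite_ktuples:
  assumes "finite V"
  shows "finite (ktuples V k)"
proof -
  have "ktuples V k \<subseteq> {x. \<forall>e. (e \<in> V \<longrightarrow> x e \<in> {0..k}) \<and> (e \<notin> V \<longrightarrow> x e = 0)}"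
    by (auto simp: ktuples_def)
  then show ?thesis
    by (rule finite_subset) (rule finite_set_of_finite_funs[OF assms finite_atLeastAtMost])
qed

lemma zero_tuple_in_ktuples: "zero_tuple \<in> ktuples V k"
  by (simp add: ktuples_def zero_tuple_def)

lemma k_greedy_TS_in_ktuples:
  assumes "k_greedy_TS V k F j x" and fin: "finite V"
  shows "x \<in> ktuples V k \<and> card (ksupp V x) = j"
  using assms(1)
proof (induction rule: k_greedy_TS.induct)
  case start
  then show ?case by (simp add: ktuples_def zero_tuple_def ksupp_def)
next
  case (step j x e i)
  then have e: "e \<in> V" "e \<notin> ksupp V x" "i \<in> {1..k}"
    by (simp_all add: is_arg_max_def)
  then have "ksupp V (x(e := i)) = insert e (ksupp V x)"
    by (auto simp: ksupp_def)
  moreover have "finite (ksupp V x)"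
    using fin by (simp add: ksupp_def)
  ultimately have "card (ksupp V (x(e := i))) = Suc j"
    using card_insert_disjoint[of "ksupp V x" e] step.IH e(2) by metis
  moreover have "x(e := i) \<in> ktuples V k"
    using step.IH e(1,3) by (auto simp: ktuples_def)
  ultimately show ?case by blast
qed

lemma k_greedy_TS_exists:
  assumes "finite V" "k \<ge> 1" "B \<le> card V"
  shows "\<exists>x. k_greedy_TS V k F B x"
  using assms(3)
proof (induction B)
  case 0
  then show ?case using k_greedy_TS.start by blast
next
  case (Suc j)
  then obtain x where x: "k_greedy_TS V k F j x" by auto
  let ?S = "(V - ksupp V x) \<times> {1..k}"
  have "card (ksupp V x) < card V"
    using k_greedy_TS_in_ktuples[OF x assms(1)] Suc.prems by simp
  moreover have "ksupp V x \<subseteq> V" by (auto simp: ksupp_def)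
  ultimately have "V - ksupp V x \<noteq> {}" by auto
  then have ne: "?S \<noteq> {}" and fin: "finite ?S" using assms(1,2) by auto
  let ?g = "\<lambda>(e, i). marginal F e i x"
  have "Max (?g ` ?S) \<in> ?g ` ?S"
    using ne fin by (intro Max_in) auto
  then obtain p where p: "p \<in> ?S" "?g p = Max (?g ` ?S)"
    by (rule imageE) (rule that, assumption, rule sym)
  have le: "?g q \<le> ?g p" if "q \<in> ?S" for q
    unfolding p(2) using that fin by (intro Max_ge finite_imageI imageI)
  obtain e i where ei: "p = (e, i)" by (cases p)
  have "is_arg_max ?g (\<lambda>(e, i). e \<in> V - ksupp V x \<and> i \<in> {1..k}) (e, i)"
    unfolding is_arg_max_def
  proof (intro conjI notI)
    show "case (e, i) of (e, i) \<Rightarrow> e \<in> V - ksupp V x \<and> i \<in> {1..k}"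
      using p(1) ei by simp
  next
    assume "\<exists>q. (case q of (e, i) \<Rightarrow> e \<in> V - ksupp V x \<and> i \<in> {1..k}) \<and> ?g (e, i) < ?g q"
    then obtain q where "q \<in> ?S" "?g (e, i) < ?g q" by blast
    then show False using le[of q] unfolding ei by linarith
  qed
  then show ?case using k_greedy_TS.step[OF x] by blast
qed

end

theory Submission
  imports Defs
begin

text \<open>
  While the greedy algorithm runs, the optimal tuple is transformed step by step into the greedy
  output: whenever the greedy step assigns \<open>e\<close>, an element \<open>d\<close> of the current target that is not
  yet covered (\<open>e\<close> itself if possible) is removed and \<open>e\<close> is assigned as in the greedy step.
  By monotonicity and submodularity of the witness \<open>f\<close> the loss of one exchange is at most the
  marginal gain of \<open>d\<close> on the greedy tuple, which by the greedy choice is at most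
  \<open>(1 + \<epsilon>) / (1 - \<epsilon>) * f x' - f x\<close>, where \<open>x\<close> and \<open>x'\<close> are the greedy tuples before and after
  the step. The losses telescope up to an error \<open>2 * \<epsilon> / (1 - \<epsilon>) * f x\<close> per step.
\<close>

lemma tuple_le_iff:
  assumes "x \<in> ktuples V k" "y \<in> ktuples V k"
  shows "tuple_le V k x y \<longleftrightarrow> (\<forall>e. x e \<noteq> 0 \<longrightarrow> y e = x e)"
proof
  assume le: "tuple_le V k x y"
  show "\<forall>e. x e \<noteq> 0 \<longrightarrow> y e = x e"
  proof (intro allI impI)
    fix e assume "x e \<noteq> 0"
    with assms(1) have "e \<in> V" "x e \<in> {1..k}"
      by (fastforce simp: ktuples_def)+
    with le show "y e = x e"
      by (auto simp: tuple_le_def part_def)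
  qed
qed (auto simp: tuple_le_def part_def)

lemma ktuples_upd:
  assumes "x \<in> ktuples V k" "e \<in> V" "i \<le> k"
  shows "x(e := i) \<in> ktuples V k"
  using assms by (auto simp: ktuples_def)

lemma mem_ksuppD:
  assumes "x \<in> ktuples V k" "e \<in> ksupp V x"
  shows "e \<in> V" "x e \<in> {1..k}"
  using assms by (auto simp: ktuples_def ksupp_def)

text \<open>This identifies the target with the greedy tuple once nothing is left to
  exchange.\<close>

lemma tuple_le_eqI:
  assumes "x \<in> ktuples V k" "y \<in> ktuples V k" "tuple_le V k x y" "ksupp V y \<subseteq> ksupp V x"
  shows "y = x"
proof
  fix e
  show "y e = x e"
  proof (cases "x e = 0")
    case True
    then have "e \<notin> ksupp V y"
      using assms(4) by (auto simp: ksupp_def)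
    with True assms(2) show ?thesis
      by (auto simp: ksupp_def ktuples_def)
  qed (use assms(3) tuple_le_iff[OF assms(1,2)] in blast)
qed

lemma k_monotone_nonneg:
  assumes "k_monotone V k f" "f zero_tuple = 0" "x \<in> ktuples V k"
  shows "0 \<le> f x"
proof -
  have "tuple_le V k zero_tuple x"
    by (auto simp: tuple_le_def part_def zero_tuple_def)
  then show ?thesis
    using assms zero_tuple_in_ktuples[of V k] unfolding k_monotone_def by metis
qed

text \<open>Deleting \<open>d\<close> costs its marginal gain on \<open>y(d := 0)\<close>, which
  diminishing returns bound by the gain on the smaller tuple \<open>x\<close>. The condition on
  \<open>e\<close> makes it free after the deletion, so assigning it only enlarges the tuple and
  loses nothing by monotonicity.\<close>

lemma exchange_loss_le_marginal:
  assumes mono: "k_monotone V k f" and sub: "k_submodular V k f"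
    and x: "x \<in> ktuples V k" and y: "y \<in> ktuples V k" and le: "tuple_le V k x y"
    and d: "d \<in> ksupp V y - ksupp V x"
    and e: "e \<in> V" "e = d \<or> e \<notin> ksupp V y" and i: "i \<in> {1..k}"
  shows "f y \<le> f (y(d := 0, e := i)) + marginal f d (y d) x"
proof -
  let ?h = "y(d := 0)"
  have dV: "d \<in> V" and yd: "y d \<in> {1..k}"
    using mem_ksuppD[OF y] d by auto
  have h: "?h \<in> ktuples V k"
    using ktuples_upd[OF y dV] by simp
  have h': "?h(e := i) \<in> ktuples V k"
    using ktuples_upd[OF h e(1)] i by simp
  \<comment> \<open>This is why \<open>x\<close> stays below the target after \<open>d\<close> has
    been deleted.\<close>
  have "x d = 0"
    using d dV by (auto simp: ksupp_def)
  then have "tuple_le V k x ?h"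
    using le by (auto simp: tuple_le_iff[OF x y] tuple_le_iff[OF x h])
  moreover have "d \<in> V - ksupp V ?h"
    using dV by (simp add: ksupp_def)
  ultimately have "marginal f d (y d) ?h \<le> marginal f d (y d) x"
    using sub x h yd unfolding k_submodular_def by blast
  moreover have "tuple_le V k ?h (?h(e := i))"
    using e by (auto simp: tuple_le_iff[OF h h'] ksupp_def)
  then have "f ?h \<le> f (?h(e := i))"
    using mono h h' unfolding k_monotone_def by blast
  ultimately show ?thesis
    by (simp add: marginal_def)
qed

lemma tuple_le_exchange:
  assumes "x \<in> ktuples V k" "y \<in> ktuples V k" "tuple_le V k x y"
    and "d \<in> V - ksupp V x" "e \<in> V" "i \<le> k"
  shows "tuple_le V k (x(e := i)) (y(d := 0, e := i))"
proof -
  have "y(d := 0, e := i) \<in> ktuples V k"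
    using assms by (intro ktuples_upd) auto
  then show ?thesis
    using assms
    by (auto simp: tuple_le_iff[OF assms(1,2)] tuple_le_iff[OF ktuples_upd[OF assms(1,5,6)]] ksupp_def)
qed

text \<open>The support loses \<open>d\<close> and gains at most \<open>e\<close>. The order of the
  updates also covers \<open>e = d\<close>.\<close>

lemma card_ksupp_exchange:
  assumes "finite V" "d \<in> ksupp V y" "e \<in> V" "i \<noteq> 0"
  shows "card (ksupp V (y(d := 0, e := i))) \<le> card (ksupp V y)"
proof -
  have fin: "finite (ksupp V y)"
    using assms(1) by (simp add: ksupp_def)
  have "ksupp V (y(d := 0, e := i)) = insert e (ksupp V y - {d})"
    using assms by (auto simp: ksupp_def)
  then have "card (ksupp V (y(d := 0, e := i))) \<le> Suc (card (ksupp V y - {d}))"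
    by (simp add: card_insert_le_m1 fin card_insert_if)
  also have "\<dots> = card (ksupp V y)"
    by (rule card_Suc_Diff1[OF fin assms(2)])
  finally show ?thesis .
qed

lemma greedy_marginal_le:
  assumes approx: "\<forall>z\<in>ktuples V k. (1 - \<epsilon>) * f z \<le> F z \<and> F z \<le> (1 + \<epsilon>) * f z"
    and "\<epsilon> < 1" and x: "x \<in> ktuples V k"
    and max: "is_arg_max (\<lambda>(e, i). marginal F e i x)
      (\<lambda>(e, i). e \<in> V - ksupp V x \<and> i \<in> {1..k}) (e, i)"
    and d: "d \<in> V - ksupp V x" and m: "m \<in> {1..k}"
  shows "marginal f d m x \<le> (1 + \<epsilon>) / (1 - \<epsilon>) * f (x(e := i)) - f x"
proof -
  have e: "e \<in> V" "i \<in> {1..k}"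
    and "\<not> marginal F e i x < marginal F d m x"
    using max d m unfolding is_arg_max_def by auto
  \<comment> \<open>The term \<open>F x\<close> cancels from the two gains, so the approximation
    error enters only through the updated tuples, not through \<open>x\<close>.\<close>
  then have "F (x(d := m)) \<le> F (x(e := i))"
    by (simp add: marginal_def)
  moreover have "x(d := m) \<in> ktuples V k" "x(e := i) \<in> ktuples V k"
    using x d m e by (auto intro!: ktuples_upd)
  ultimately have "(1 - \<epsilon>) * f (x(d := m)) \<le> (1 + \<epsilon>) * f (x(e := i))"
    using approx by (meson order_trans)
  then show ?thesis
    using \<open>\<epsilon> < 1\<close> by (simp add: marginal_def field_simps)
qed

text \<open>Here \<open>z\<close> is the current target. In the coefficient of \<open>f x\<close>,
  the \<open>1\<close> comes from the telescoping gains and the remainder from \<open>j\<close>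
  approximation errors, all charged to the current greedy value.\<close>

lemma greedy_invariant:
  assumes "k_greedy_TS V k F j x" "finite V" "j \<le> B"
    and mono: "k_monotone V k f" and sub: "k_submodular V k f" and f0: "f zero_tuple = 0"
    and approx: "\<forall>z\<in>ktuples V k. (1 - \<epsilon>) * f z \<le> F z \<and> F z \<le> (1 + \<epsilon>) * f z"
    and eps: "0 < \<epsilon>" "\<epsilon> < 1"
    and y: "y \<in> ktuples V k" "card (ksupp V y) \<le> B"
  shows "\<exists>z\<in>ktuples V k. tuple_le V k x z \<and> card (ksupp V z) \<le> B \<and>
    f y \<le> f z + (1 + 2 * \<epsilon> / (1 - \<epsilon>) * real j) * f x"
  using assms(1,3)
proof (induction rule: k_greedy_TS.induct)
  case start
  have "tuple_le V k zero_tuple y"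
    by (auto simp: tuple_le_def part_def zero_tuple_def)
  then show ?case
    using y f0 by auto
next
  case (step j x e i)
  \<comment> \<open>The excess of the ratio (1 + \<epsilon>) / (1 - \<epsilon>) over 1, that is, the
    error of one step relative to the greedy value.\<close>
  define c where "c = 2 * \<epsilon> / (1 - \<epsilon>)"
  let ?x = "x(e := i)"
  have x: "x \<in> ktuples V k"
    using k_greedy_TS_in_ktuples[OF step.hyps(1) assms(2)] by simp
  have x': "?x \<in> ktuples V k" "card (ksupp V ?x) = Suc j"
    using k_greedy_TS_in_ktuples[OF k_greedy_TS.step[OF step.hyps] assms(2)] by auto
  obtain z where z: "z \<in> ktuples V k" "tuple_le V k x z" "card (ksupp V z) \<le> B"
    and fy: "f y \<le> f z + (1 + c * real j) * f x"
    using step.IH step.prems by (auto simp: c_def)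
  have e: "e \<in> V" "e \<notin> ksupp V x" "i \<in> {1..k}"
    using step.hyps(2) by (auto simp: is_arg_max_def)
  have c: "0 < c" "(1 + \<epsilon>) / (1 - \<epsilon>) = 1 + c"
    using eps by (auto simp: c_def field_simps)
  have "tuple_le V k x ?x"
    using e by (auto simp: tuple_le_iff[OF x x'(1)] ksupp_def)
  then have fx: "f x \<le> f ?x"
    using mono x x'(1) unfolding k_monotone_def by blast
  have fx0: "0 \<le> f ?x"
    using k_monotone_nonneg[OF mono f0 x'(1)] .
  have "\<exists>z'\<in>ktuples V k. tuple_le V k ?x z' \<and> card (ksupp V z') \<le> B \<and>
    f z \<le> f z' + ((1 + c) * f ?x - f x)"
  \<comment> \<open>If the greedy tuple has exhausted the target, the new greedy tuple becomes the
    target. It has \<open>Suc j\<close> assigned elements, so the bound \<open>Suc j \<le> B\<close>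
    is what keeps it admissible.\<close>
  proof (cases "ksupp V z \<subseteq> ksupp V x")
    case True
    then have "z = x"
      using tuple_le_eqI[OF x z(1,2)] by simp
    moreover have "0 \<le> c * f ?x"
      using c(1) fx0 by simp
    then have "f x \<le> f ?x + ((1 + c) * f ?x - f x)"
      using fx by (simp add: algebra_simps)
    moreover have "tuple_le V k ?x ?x"
      by (simp add: tuple_le_def)
    ultimately show ?thesis
      using x' step.prems by auto
  next
    case False
    \<comment> \<open>If \<open>e\<close> lies in the support of \<open>z\<close>, then
      \<open>d = e\<close> works, since \<open>e\<close> is new to \<open>x\<close>. Otherwise any
      uncovered element does.\<close>
    then obtain d where d: "d \<in> ksupp V z - ksupp V x" and de: "e = d \<or> e \<notin> ksupp V z"
      using e(2) by blast
    have dV: "d \<in> V" "z d \<in> {1..k}"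
      using mem_ksuppD[OF z(1)] d by auto
    have "marginal f d (z d) x \<le> (1 + c) * f ?x - f x"
      using greedy_marginal_le[OF approx eps(2) x step.hyps(2) _ dV(2)] d dV(1) c(2) by simp
    then have "f z \<le> f (z(d := 0, e := i)) + ((1 + c) * f ?x - f x)"
      using exchange_loss_le_marginal[OF mono sub x z(1,2) d e(1) de e(3)] by linarith
    moreover have "tuple_le V k ?x (z(d := 0, e := i))"
      using tuple_le_exchange[OF x z(1,2)] d dV(1) e by simp
    moreover have "card (ksupp V (z(d := 0, e := i))) \<le> B"
      using card_ksupp_exchange[OF assms(2), of d z e i] d e z(3) by auto
    moreover have "z(d := 0, e := i) \<in> ktuples V k"
      using z(1) dV(1) e by (intro ktuples_upd) auto
    ultimately show ?thesis by blast
  qed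
  then obtain z' where z': "z' \<in> ktuples V k" "tuple_le V k ?x z'" "card (ksupp V z') \<le> B"
    and fz: "f z \<le> f z' + ((1 + c) * f ?x - f x)"
    by blast
  \<comment> \<open>Earlier errors are charged again to the larger value \<open>f ?x\<close>, so
    that they add up with the error of the new step.\<close>
  have "c * real j * f x \<le> c * real j * f ?x"
    using fx c(1) by (intro mult_left_mono) auto
  with fy fz have "f y \<le> f z' + (1 + c * real (Suc j)) * f ?x"
    by (simp add: algebra_simps)
  with z' show ?case
    unfolding c_def by blast
qed

text \<open>After \<open>B\<close> steps the greedy support already has \<open>B\<close> elements,
  so the target above it, with at most \<open>B\<close> elements, is \<open>x\<close> itself. Thus
  \<open>f z\<close> contributes a second copy of \<open>f x\<close>, whence the factor 2.\<close>

lemma greedy_witness_bound: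
  assumes "k_greedy_TS V k F B x" "finite V"
    and "k_monotone V k f" "k_submodular V k f" "f zero_tuple = 0"
    and "\<forall>z\<in>ktuples V k. (1 - \<epsilon>) * f z \<le> F z \<and> F z \<le> (1 + \<epsilon>) * f z"
    and eps: "0 < \<epsilon>" "\<epsilon> < 1"
    and "y \<in> ktuples V k" "card (ksupp V y) \<le> B"
  shows "(1 - \<epsilon>) * f y \<le> 2 * (1 - \<epsilon> + \<epsilon> * real B) * f x"
proof -
  obtain z where z: "z \<in> ktuples V k" "tuple_le V k x z" "card (ksupp V z) \<le> B"
    and fy: "f y \<le> f z + (1 + 2 * \<epsilon> / (1 - \<epsilon>) * real B) * f x"
    using greedy_invariant[OF assms(1,2) order_refl assms(3-)] by blast
  have x: "x \<in> ktuples V k" "card (ksupp V x) = B"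
    using k_greedy_TS_in_ktuples[OF assms(1,2)] by auto
  have "finite (ksupp V z)"
    using assms(2) by (simp add: ksupp_def)
  moreover have "ksupp V x \<subseteq> ksupp V z"
    using z(2) by (auto simp: tuple_le_iff[OF x(1) z(1)] ksupp_def)
  ultimately have "ksupp V x = ksupp V z"
    using x(2) z(3) card_seteq by metis
  then have "z = x"
    using tuple_le_eqI[OF x(1) z(1,2)] by simp
  with fy have "f y \<le> (2 + 2 * \<epsilon> / (1 - \<epsilon>) * real B) * f x"
    by (simp add: algebra_simps)
  then have "(1 - \<epsilon>) * f y \<le> (1 - \<epsilon>) * ((2 + 2 * \<epsilon> / (1 - \<epsilon>) * real B) * f x)"
    using eps by (intro mult_left_mono) auto
  also have "\<dots> = 2 * (1 - \<epsilon> + \<epsilon> * real B) * f x"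
    using eps by (simp add: field_simps)
  finally show ?thesis .
qed

theorem theorem4:
  fixes n k B :: nat
    and \<epsilon> :: real
    and V :: "nat set"
    and F :: "(nat \<Rightarrow> nat) \<Rightarrow> real"
    and x :: "nat \<Rightarrow> nat"
  assumes "V = {1..n}"
    and "k \<ge> 1"
    and "0 < \<epsilon>" and "\<epsilon> < 1"
    and "B \<ge> 1" and "B \<le> n"
    and "\<forall>z\<in>ktuples V k. F z \<ge> 0"
    and "approx_k_submodular V k \<epsilon> F"
    and "k_greedy_TS V k F B x"
  shows "F x \<ge> (1 - \<epsilon>)\<^sup>2 / (2 * (1 - \<epsilon> + \<epsilon> * real B) * (1 + \<epsilon>))
           * Max {F y |y. y \<in> ktuples V k \<and> card (ksupp V y) \<le> B}"
proof -
  let ?S = "{F y |y. y \<in> ktuples V k \<and> card (ksupp V y) \<le> B}"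
  have fin: "finite V"
    using assms(1) by simp
  have "finite ?S"
    using finite_ktuples[OF fin, of k] by simp
  moreover have "F zero_tuple \<in> ?S"
    using zero_tuple_in_ktuples[of V k] by (force simp: ksupp_def zero_tuple_def)
  ultimately have "Max ?S \<in> ?S"
    by (intro Max_in) auto
  then obtain y where y: "y \<in> ktuples V k" "card (ksupp V y) \<le> B" and max: "Max ?S = F y"
    by blast
  obtain f where f: "k_monotone V k f" "k_submodular V k f" "f zero_tuple = 0"
    and approx: "\<forall>z\<in>ktuples V k. (1 - \<epsilon>) * f z \<le> F z \<and> F z \<le> (1 + \<epsilon>) * f z"
    using assms(8) unfolding approx_k_submodular_def by blast
  have x: "x \<in> ktuples V k"
    using k_greedy_TS_in_ktuples[OF assms(9) fin] by simp
  define D where "D = 2 * (1 - \<epsilon> + \<epsilon> * real B)"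
  have "0 < D"
    using assms(3,4) by (simp add: D_def add_pos_nonneg)
  \<comment> \<open>One factor 1 - \<epsilon> feeds the bound for the witness, the other turns
    \<open>f x\<close> back into \<open>F x\<close>; the factor 1 + \<epsilon> is the price of
    replacing \<open>F y\<close> by \<open>f y\<close>.\<close>
  have "(1 - \<epsilon>)\<^sup>2 * F y \<le> (1 - \<epsilon>)\<^sup>2 * ((1 + \<epsilon>) * f y)"
    using approx y(1) by (intro mult_left_mono) auto
  also have "\<dots> = (1 - \<epsilon>) * (1 + \<epsilon>) * ((1 - \<epsilon>) * f y)"
    by (simp add: power2_eq_square)
  also have "\<dots> \<le> (1 - \<epsilon>) * (1 + \<epsilon>) * (D * f x)"
    using greedy_witness_bound[OF assms(9) fin f approx assms(3,4) y] assms(3,4)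
    unfolding D_def by (intro mult_left_mono) auto
  also have "\<dots> = D * (1 + \<epsilon>) * ((1 - \<epsilon>) * f x)"
    by simp
  also have "\<dots> \<le> D * (1 + \<epsilon>) * F x"
    using approx x \<open>0 < D\<close> assms(3) by (intro mult_left_mono) auto
  finally have "(1 - \<epsilon>)\<^sup>2 * F y / (D * (1 + \<epsilon>)) \<le> F x"
    using \<open>0 < D\<close> assms(3) by (simp add: pos_divide_le_eq mult.commute)
  then show ?thesis
    unfolding max D_def by simp
qed

end
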